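(* For $n\ge 2$, let $\lambda_n$ denote the number of distinct subgroups of $T_n$ of the form $C_{T_n}(w)$, where $w$ ranges over the cyclically reduced involutions of $T_n$, that is, over the set $\mathcal{A}_n$. Then, for $n\ge 7$, $$\lambda_n=\Big(\sum_{i=3}^{n-2}\lambda_i\Big)-\lambda_{n-4}+n-2.$$
   Context: For an integer $n\ge 2$, the twin group $T_n$ is the group generated by $s_1,\dots,s_{n-1}$ with defining relations $s_i^2=1$ for all $i$, and $s_is_j=s_js_i$ whenever $|i-j|\ge 2$. $C_{T_n}(w)$ denotes the centraliser of $w$ in $T_n$. The set $\mathcal{A}_n$ of cyclically reduced involutions (up to reordering commuting letters) is $$\mathcal{A}_n=\{s_{i_1}s_{i_2}\cdots s_{i_k}\mid k\ge 1,\ 1\le i_t\le n-1,\ i_{t+1}-i_t\ge 2\}.$$ Two elements of a group $G$ are $z$-equivalent if their centralisers are conjugate in $G$; the equivalence classes are called $z$-classes. The number $\lambda_n$ is the number of $z$-classes of involutions in $T_n$. *)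

theory Defs
  imports "HOL-Algebra.Group"
begin

section \<open>Groups given by generators and relations\<close>

text \<open>A letter \<open>(x, True)\<close> stands for the generator \<open>x\<close>, and \<open>(x, False)\<close> for its formal inverse.
  A defining relation \<open>l = r\<close> is the pair \<open>(l, r)\<close> of words.\<close>

type_synonym 'a word = "('a \<times> bool) list"

abbreviation words_over :: "'a set \<Rightarrow> 'a word set" where
  "words_over S \<equiv> lists (S \<times> UNIV)"

inductive_set pres_rel :: "'a set \<Rightarrow> ('a word \<times> 'a word) set \<Rightarrow> ('a word \<times> 'a word) set"
  for S :: "'a set" and R :: "('a word \<times> 'a word) set" where
  refl: "u \<in> words_over S \<Longrightarrow> (u, u) \<in> pres_rel S R"
| sym: "(u, v) \<in> pres_rel S R \<Longrightarrow> (v, u) \<in> pres_rel S R"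
| trans: "(u, v) \<in> pres_rel S R \<Longrightarrow> (v, w) \<in> pres_rel S R \<Longrightarrow> (u, w) \<in> pres_rel S R"
| cancel: "x \<in> S \<Longrightarrow> u \<in> words_over S \<Longrightarrow> v \<in> words_over S
    \<Longrightarrow> (u @ [(x, b), (x, \<not> b)] @ v, u @ v) \<in> pres_rel S R"
| relation: "(l, r) \<in> R \<Longrightarrow> l \<in> words_over S \<Longrightarrow> r \<in> words_over S
    \<Longrightarrow> u \<in> words_over S \<Longrightarrow> v \<in> words_over S \<Longrightarrow> (u @ l @ v, u @ r @ v) \<in> pres_rel S R"

definition presented_group :: "'a set \<Rightarrow> ('a word \<times> 'a word) set \<Rightarrow> 'a word set monoid" where
  "presented_group S R =
     \<lparr> carrier = words_over S // pres_rel S R,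
       mult = (\<lambda>A B. \<Union>a\<in>A. \<Union>b\<in>B. pres_rel S R `` {a @ b}),
       one = pres_rel S R `` {[]} \<rparr>"

lemma pres_rel_words:
  assumes "(u, v) \<in> pres_rel S R"
  shows "u \<in> words_over S \<and> v \<in> words_over S"
  using assms by induction auto

lemma equiv_pres_rel: "equiv (words_over S) (pres_rel S R)"
proof (rule equivI)
  show "pres_rel S R \<subseteq> words_over S \<times> words_over S"
    using pres_rel_words by fast
  show "refl_on (words_over S) (pres_rel S R)"
    by (rule refl_onI) (rule pres_rel.refl)
  show "sym (pres_rel S R)"
    by (rule symI) (rule pres_rel.sym)
  show "trans (pres_rel S R)"
    by (rule transI) (rule pres_rel.trans)
qed

lemma pres_rel_append_left:
  assumes "(u, v) \<in> pres_rel S R" "w \<in> words_over S"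
  shows "(w @ u, w @ v) \<in> pres_rel S R"
  using assms
proof induction
  case (cancel x u v b)
  then show ?case using pres_rel.cancel[of x S "w @ u" v b R] by simp
next
  case (relation l r u v)
  then show ?case using pres_rel.relation[of l r R S "w @ u" v] by simp
next
  case (refl u)
  then show ?case by (intro pres_rel.refl append_in_lists_conv[THEN iffD2] conjI)
qed (blast intro: pres_rel.sym pres_rel.trans)+

lemma pres_rel_append_right:
  assumes "(u, v) \<in> pres_rel S R" "w \<in> words_over S"
  shows "(u @ w, v @ w) \<in> pres_rel S R"
  using assms
proof induction
  case (cancel x u v b)
  then show ?case using pres_rel.cancel[of x S u "v @ w" b R] by simp
next
  case (relation l r u v)
  then show ?case using pres_rel.relation[of l r R S u "v @ w"] by simp
next
  case (refl u)
  then show ?case by (intro pres_rel.refl append_in_lists_conv[THEN iffD2] conjI)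
qed (blast intro: pres_rel.sym pres_rel.trans)+

lemma pres_rel_append:
  assumes "(a, a') \<in> pres_rel S R" "(b, b') \<in> pres_rel S R"
  shows "(a @ b, a' @ b') \<in> pres_rel S R"
  using assms pres_rel_append_left pres_rel_append_right pres_rel_words pres_rel.trans
  by meson

lemma presented_group_mult:
  assumes "a \<in> words_over S" "b \<in> words_over S"
  shows "pres_rel S R `` {a} \<otimes>\<^bsub>presented_group S R\<^esub> pres_rel S R `` {b} = pres_rel S R `` {a @ b}"
proof -
  let ?c = "\<lambda>u. pres_rel S R `` {u}"
  have eq: "?c (a' @ b') = ?c (a @ b)"
    if "(a, a') \<in> pres_rel S R" "(b, b') \<in> pres_rel S R" for a' b'
    using equiv_class_eq[OF equiv_pres_rel pres_rel_append[OF that]] by simp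
  have "(\<Union>a'\<in>?c a. \<Union>b'\<in>?c b. ?c (a' @ b')) = (\<Union>a'\<in>?c a. \<Union>b'\<in>?c b. ?c (a @ b))"
    by (intro SUP_cong refl eq) (simp_all only: Image_singleton_iff)
  moreover have "a \<in> ?c a" "b \<in> ?c b"
    using assms by (simp_all only: Image_singleton_iff pres_rel.refl)
  ultimately show ?thesis
    unfolding presented_group_def by force
qed

lemma inverse_word:
  "u \<in> words_over S \<Longrightarrow> rev (map (\<lambda>(x, b). (x, \<not> b)) u) \<in> words_over S"
  by (induction u) auto

lemma pres_rel_inverse:
  assumes "u \<in> words_over S"
  shows "(rev (map (\<lambda>(x, b). (x, \<not> b)) u) @ u, []) \<in> pres_rel S R"
  using assms
proof (induction u rule: list.induct)
  case Nil
  then show ?case by (simp add: pres_rel.refl)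
next
  case (Cons y u)
  obtain x b where y: "y = (x, b)" by (cases y)
  let ?u = "rev (map (\<lambda>(x, b). (x, \<not> b)) u)"
  have xu: "x \<in> S" "u \<in> words_over S" using Cons.prems y by simp_all
  then have "(?u @ [(x, \<not> b), (x, b)] @ u, ?u @ u) \<in> pres_rel S R"
    using pres_rel.cancel[of x S ?u u "\<not> b" R] inverse_word[OF xu(2)] by simp
  then have "(?u @ [(x, \<not> b), (x, b)] @ u, []) \<in> pres_rel S R"
    using Cons.IH[OF xu(2)] by (rule pres_rel.trans)
  then show ?case by (simp add: y)
qed

lemma group_presented_group: "group (presented_group S R)"
proof (rule groupI)
  let ?G = "presented_group S R" and ?c = "\<lambda>u. pres_rel S R `` {u}"
  have car: "carrier ?G = ?c ` words_over S"
    by (auto simp: presented_group_def quotient_def)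
  have one: "\<one>\<^bsub>?G\<^esub> = ?c []"
    by (simp add: presented_group_def)
  show "\<one>\<^bsub>?G\<^esub> \<in> carrier ?G"
    by (auto simp: car one)
  show "x \<otimes>\<^bsub>?G\<^esub> y \<in> carrier ?G" if xy: "x \<in> carrier ?G" "y \<in> carrier ?G" for x y
  proof -
    obtain a b where "x = ?c a" "y = ?c b" and w: "a \<in> words_over S" "b \<in> words_over S"
      using xy unfolding car by blast
    then have "x \<otimes>\<^bsub>?G\<^esub> y = ?c (a @ b)"
      by (simp only: presented_group_mult)
    moreover have "a @ b \<in> words_over S" using w by auto
    ultimately show ?thesis by (simp add: car del: in_lists_conv_set)
  qed
  show "x \<otimes>\<^bsub>?G\<^esub> y \<otimes>\<^bsub>?G\<^esub> z = x \<otimes>\<^bsub>?G\<^esub> (y \<otimes>\<^bsub>?G\<^esub> z)"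
    if xyz: "x \<in> carrier ?G" "y \<in> carrier ?G" "z \<in> carrier ?G" for x y z
  proof -
    obtain a b c where "x = ?c a" "y = ?c b" "z = ?c c"
      and w: "a \<in> words_over S" "b \<in> words_over S" "c \<in> words_over S"
      using xyz unfolding car by blast
    moreover have "a @ b \<in> words_over S" "b @ c \<in> words_over S" using w by auto
    ultimately show ?thesis by (simp only: presented_group_mult append_assoc)
  qed
  show "\<one>\<^bsub>?G\<^esub> \<otimes>\<^bsub>?G\<^esub> x = x" if x: "x \<in> carrier ?G" for x
  proof -
    obtain a where a: "x = ?c a" "a \<in> words_over S" using x unfolding car by blast
    show ?thesis using presented_group_mult[of "[]" S a R] a by (simp add: one)
  qed
  show "\<exists>y\<in>carrier ?G. y \<otimes>\<^bsub>?G\<^esub> x = \<one>\<^bsub>?G\<^esub>" if x: "x \<in> carrier ?G" for x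
  proof -
    obtain a where a: "x = ?c a" "a \<in> words_over S" using x unfolding car by blast
    let ?a = "rev (map (\<lambda>(x, b). (x, \<not> b)) a)"
    have w: "?a \<in> words_over S" using a(2) by (rule inverse_word)
    have "?c ?a \<otimes>\<^bsub>?G\<^esub> x = \<one>\<^bsub>?G\<^esub>"
      using presented_group_mult[OF w a(2)] equiv_class_eq[OF equiv_pres_rel pres_rel_inverse[OF a(2)]]
      by (simp add: a(1) one)
    then show ?thesis using w car by blast
  qed
qed

section \<open>Twin groups\<close>

definition twin_relations :: "nat \<Rightarrow> (nat word \<times> nat word) set" where
  "twin_relations n =
     {([(i, True), (i, True)], []) | i. i \<in> {1..n - 1}} \<union>
     {([(i, True), (j, True)], [(j, True), (i, True)]) | i j.
        i \<in> {1..n - 1} \<and> j \<in> {1..n - 1} \<and> \<bar>int i - int j\<bar> \<ge> 2}"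

definition twin_group :: "nat \<Rightarrow> nat word set monoid" where
  "twin_group n = presented_group {1..n - 1} (twin_relations n)"

definition twin_gen :: "nat \<Rightarrow> nat \<Rightarrow> nat word set" where
  "twin_gen n i = pres_rel {1..n - 1} (twin_relations n) `` {[(i, True)]}"

definition centraliser :: "('a, 'b) monoid_scheme \<Rightarrow> 'a \<Rightarrow> 'a set" where
  "centraliser G w = {g \<in> carrier G. g \<otimes>\<^bsub>G\<^esub> w = w \<otimes>\<^bsub>G\<^esub> g}"

text \<open>The cyclically reduced involutions of the twin group, up to reordering commuting letters:
  products \<open>s\<^sub>i\<^sub>1 \<cdots> s\<^sub>i\<^sub>k\<close> with \<open>k \<ge> 1\<close> and consecutive indices increasing by at least 2.\<close>

definition cyc_red_involutions :: "nat \<Rightarrow> nat word set set" where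
  "cyc_red_involutions n =
     {foldr (\<otimes>\<^bsub>twin_group n\<^esub>) (map (twin_gen n) is) \<one>\<^bsub>twin_group n\<^esub> | is.
        is \<noteq> [] \<and> set is \<subseteq> {1..n - 1} \<and> successively (\<lambda>i j. i + 2 \<le> j) is}"

definition twin_lambda :: "nat \<Rightarrow> nat" where
  "twin_lambda n = card (centraliser (twin_group n) ` cyc_red_involutions n)"

end

theory Submission
  imports Defs "HOL-Library.Multiset"
begin

text \<open>
  In a right-angled Coxeter group, a product \<open>w\<close> of pairwise commuting generators \<open>I\<close> has as centraliser
  the parabolic subgroup on the letters that commute with all of \<open>I\<close>: if \<open>g\<close> is reduced, commutes with
  \<open>w\<close> and starts with no letter of \<open>I\<close>, then \<open>w g\<close> and \<open>g w\<close> are reduced words for the same element,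
  so they agree after deleting all letters except \<open>i \<in> I\<close> and a non-commuting \<open>x\<close>; hence \<open>i\<close> commutes
  with the projection of \<open>g\<close> in the free monoid, and \<open>x\<close> does not occur in \<open>g\<close>.

  For the twin group this makes \<open>\<lambda>\<^sub>n\<close> the number of distinct neighbourhoods of nonempty independent
  sets in the path on \<open>n - 1\<close> vertices. A gap of size 4 between consecutive elements, or between an
  extreme element and a virtual one at \<open>-1\<close> or \<open>n + 1\<close>, may be filled by its midpoint without changing
  the neighbourhood; after that the neighbourhood determines the set. Recording the gaps, one counts
  compositions of \<open>n + 2\<close> into at least two parts from \<open>{2, 3, 5, 6, \<dots>}\<close>, and the recurrence
  follows by splitting off the first part.
\<close>

section \<open>The word problem for right-angled Coxeter groups\<close>

locale dependence =
  fixes dep :: "'a \<Rightarrow> 'a \<Rightarrow> bool"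
  assumes dep_refl [simp]: "dep x x"
    and dep_sym: "dep x y \<Longrightarrow> dep y x"
begin

definition proj :: "'a \<Rightarrow> 'a \<Rightarrow> 'a list \<Rightarrow> 'a list" where
  "proj a b = filter (\<lambda>x. x = a \<or> x = b)"

text \<open>Equality up to swapping commuting neighbours. A trace is determined by its projections to pairs
  of dependent letters, so no rewriting is needed to decide it.\<close>

definition teq :: "'a list \<Rightarrow> 'a list \<Rightarrow> bool" where
  "teq u v \<longleftrightarrow> (\<forall>a b. dep a b \<longrightarrow> proj a b u = proj a b v)"

text \<open>Some word trace equivalent to \<open>w\<close> starts with \<open>s\<close>; the case \<open>b = s\<close> forces \<open>s\<close> to occur.\<close>

definition initial :: "'a \<Rightarrow> 'a list \<Rightarrow> bool" where
  "initial s w \<longleftrightarrow> (\<forall>b. dep s b \<longrightarrow> (\<exists>v. proj s b w = s # v))"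

text \<open>Left multiplication by a generator, acting on reduced words up to \<open>teq\<close>;
  checking the defining relations for it makes \<open>nf\<close> an invariant of group
  elements.\<close>

definition act :: "'a \<Rightarrow> 'a list \<Rightarrow> 'a list" where
  "act s w = (if initial s w then remove1 s w else s # w)"

definition nf :: "'a list \<Rightarrow> 'a list" where
  "nf w = foldr act w []"

primrec reduced :: "'a list \<Rightarrow> bool" where
  "reduced [] \<longleftrightarrow> True"
| "reduced (x # w) \<longleftrightarrow> \<not> initial x w \<and> reduced w"

section \<open>Trace equivalence and initial letters\<close>

lemma teq_refl [simp]: "teq w w"
  by (simp add: teq_def)

lemma teq_sym: "teq u v \<Longrightarrow> teq v u"
  by (simp add: teq_def)

lemma teq_trans [trans]: "teq u v \<Longrightarrow> teq v w \<Longrightarrow> teq u w"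
  by (simp add: teq_def)

lemma proj_append [simp]: "proj a b (u @ v) = proj a b u @ proj a b v"
  by (simp add: proj_def)

lemma proj_Cons: "proj a b (x # v) = (if x = a \<or> x = b then x # proj a b v else proj a b v)"
  by (simp add: proj_def)

lemma proj_remove1: "proj a b (remove1 s w) = remove1 s (proj a b w)"
  by (simp add: proj_def filter_remove1)

lemma proj_remove1_other:
  assumes "s \<noteq> a" "s \<noteq> b"
  shows "proj a b (remove1 s w) = proj a b w"
  using assms by (induction w) (auto simp: proj_def)

lemma proj_commute: "proj a b w = proj b a w"
  by (simp add: proj_def disj_commute)

lemma teq_mset:
  assumes "teq u v"
  shows "mset u = mset v"
proof (rule multiset_eqI)
  fix a
  have "count (mset w) a = length (proj a a w)" for w
    by (induction w) (auto simp: proj_def)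
  then show "count (mset u) a = count (mset v) a"
    using assms by (simp add: teq_def)
qed

lemma not_initial_Nil [simp]: "\<not> initial s []"
proof
  assume "initial s []"
  then have "\<exists>v. proj s s [] = s # v"
    unfolding initial_def using dep_refl by blast
  then show False by (simp add: proj_def)
qed

lemma initial_Cons_same [simp]: "initial s (s # w)"
  by (simp add: initial_def proj_Cons)

text \<open>If \<open>x\<close> depended on \<open>s\<close>, the projection to \<open>s\<close> and
  \<open>x\<close> would start with \<open>x\<close>; otherwise \<open>x\<close> drops out of every
  projection that is tested.\<close>

lemma initial_Cons_other:
  assumes "x \<noteq> s"
  shows "initial s (x # w) \<longleftrightarrow> \<not> dep s x \<and> initial s w"
proof
  assume init: "initial s (x # w)"
  then have indep: "\<not> dep s x"
    using assms by (force simp: initial_def proj_Cons)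
  with init assms have "initial s w"
    unfolding initial_def proj_Cons by metis
  with indep show "\<not> dep s x \<and> initial s w" ..
next
  assume "\<not> dep s x \<and> initial s w"
  with assms show "initial s (x # w)"
    unfolding initial_def proj_Cons by metis
qed

lemma initial_in_set: "initial s w \<Longrightarrow> s \<in> set w"
proof (induction w)
  case (Cons x w)
  then show ?case by (cases "x = s") (auto simp: initial_Cons_other)
qed simp

lemma initial_cong: "teq u v \<Longrightarrow> initial s u = initial s v"
  by (simp add: initial_def teq_def)

lemma initial_remove1_other:
  assumes "\<not> dep s x"
  shows "initial x (remove1 s w) = initial x w"
proof -
  have "proj x b (remove1 s w) = proj x b w" if "dep x b" for b
    using assms that dep_sym dep_refl by (metis proj_remove1_other)
  then show ?thesis by (simp add: initial_def)
qed

section \<open>The action of the generators on reduced words\<close>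

lemma initial_act_other:
  assumes "\<not> dep s x"
  shows "initial x (act s w) = initial x w"
proof -
  have "s \<noteq> x" "\<not> dep x s" using assms dep_sym by auto
  then show ?thesis
    using assms by (simp add: act_def initial_remove1_other initial_Cons_other)
qed

text \<open>Letters before the first \<open>s\<close> are independent of \<open>s\<close>, so they
  stay non-initial, and \<open>s\<close> is not initial in what follows. The second conjunct makes
  \<open>act s\<close> an involution on reduced words.\<close>

lemma reduced_remove1:
  assumes "reduced w" "initial s w"
  shows "reduced (remove1 s w) \<and> \<not> initial s (remove1 s w)"
  using assms
proof (induction w)
  case (Cons x w)
  then show ?case
    by (cases "x = s") (auto simp: initial_Cons_other initial_remove1_other)
qed simp

text \<open>An initial \<open>s\<close> heads every dependent projection containing it, so removal
  there is \<open>tl\<close>.\<close>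

lemma proj_act:
  assumes "dep a b"
  shows "proj a b (act s w) =
    (if s = a \<or> s = b then if initial s w then tl (proj a b w) else s # proj a b w
     else proj a b w)"
proof (cases "s = a \<or> s = b")
  case True
  have "remove1 s (proj a b w) = tl (proj a b w)" if "initial s w"
    using True that assms dep_sym
    by (fastforce simp: initial_def proj_commute[of a b])
  with True show ?thesis
    by (simp add: act_def proj_remove1 proj_Cons)
next
  case False
  then show ?thesis
    by (simp add: act_def proj_remove1_other proj_Cons)
qed

lemma act_cong: "teq u v \<Longrightarrow> teq (act s u) (act s v)"
  using initial_cong[of u v s] by (simp add: teq_def proj_act)

lemma foldr_act_cong: "teq u v \<Longrightarrow> teq (foldr act w u) (foldr act w v)"
  by (induction w) (auto intro: act_cong)

lemma reduced_act: "reduced w \<Longrightarrow> reduced (act s w)"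
  by (simp add: act_def reduced_remove1)

lemma reduced_foldr_act: "reduced w \<Longrightarrow> reduced (foldr act u w)"
  by (induction u) (auto intro: reduced_act)

lemma reduced_nf [simp]: "reduced (nf w)"
  by (simp add: nf_def reduced_foldr_act)

lemma teq_Cons_remove1:
  assumes "initial s w"
  shows "teq (s # remove1 s w) w"
  unfolding teq_def
proof (intro allI impI)
  fix a b assume ab: "dep a b"
  have "\<exists>v. proj a b w = s # v" if "s = a \<or> s = b"
    using that assms ab dep_sym by (auto simp: initial_def proj_commute[of a b])
  then show "proj a b (s # remove1 s w) = proj a b w"
    by (cases "s = a \<or> s = b") (force simp: proj_Cons proj_remove1, simp add: proj_Cons proj_remove1_other)
qed

text \<open>Reducedness prevents a second cancellation: acting twice by \<open>s\<close> on
  \<open>[s, s]\<close> would end at \<open>[]\<close>.\<close>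

lemma act_act_same:
  assumes "reduced w"
  shows "teq (act s (act s w)) w"
  using assms reduced_remove1[of w s]
  by (auto simp: act_def teq_Cons_remove1)

text \<open>No dependent pair contains both letters, and neither action changes whether the other
  letter is initial.\<close>

lemma act_commute:
  assumes "\<not> dep s t"
  shows "teq (act s (act t w)) (act t (act s w))"
proof -
  have st: "\<not> dep t s" "s \<noteq> t" using assms dep_sym by auto
  show ?thesis
    unfolding teq_def using assms st dep_sym
    by (auto simp: proj_act initial_act_other)
qed

section \<open>Normal forms\<close>

lemma nf_append: "nf (u @ v) = foldr act u (nf v)"
  by (simp add: nf_def)

lemma nf_reduced: "reduced w \<Longrightarrow> nf w = w"
  by (induction w) (auto simp: nf_def act_def)

lemma set_act: "set (act s w) \<subseteq> insert s (set w)"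
  using set_remove1_subset[of s w] by (auto simp: act_def)

lemma set_nf: "set (nf w) \<subseteq> set w"
  using set_act by (induction w) (fastforce simp: nf_def)+

lemma length_act:
  "length (act s w) \<le> Suc (length w)" "length (act s w) = Suc (length w) \<Longrightarrow> act s w = s # w"
  by (auto simp: act_def length_remove1 split: if_splits)

lemma length_nf: "length (nf w) \<le> length w"
proof (induction w)
  case (Cons x w)
  then show ?case using length_act(1)[of x "nf w"] by (simp add: nf_def)
qed (simp add: nf_def)

text \<open>Each \<open>act\<close> lengthens the word by one or cancels, so keeping the full length
  means that nothing was cancelled.\<close>

lemma nf_eq_if_length: "length (nf w) = length w \<Longrightarrow> nf w = w"
proof (induction w)
  case (Cons x w)
  have "length (act x (nf w)) = Suc (length w)"
    using Cons.prems by (simp add: nf_def)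
  moreover from this have "length (nf w) = length w"
    using length_act(1)[of x "nf w"] length_nf[of w] by simp
  ultimately show ?case
    using Cons.IH length_act(2)[of x "nf w"] by (simp add: nf_def)
qed (simp add: nf_def)

section \<open>Products of pairwise independent letters\<close>

lemma initial_append_indep:
  assumes "\<forall>j\<in>set js. \<not> dep i j"
  shows "initial i (js @ w) = initial i w"
  using assms
proof (induction js)
  case (Cons j js)
  then have "j \<noteq> i" "\<not> dep i j" by auto
  with Cons show ?case by (simp add: initial_Cons_other)
qed simp

lemma foldr_act_append:
  assumes "sorted_wrt (\<lambda>i j. \<not> dep i j) js" "\<forall>i\<in>set js. \<not> initial i w"
  shows "foldr act js w = js @ w"
  using assms by (induction js) (auto simp: act_def initial_append_indep)

lemma Cons_eq_snoc: "i # l = l @ [i] \<Longrightarrow> set l \<subseteq> {i}"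
  by (induction l) auto

lemma proj_indep:
  assumes "sorted_wrt (\<lambda>i j. \<not> dep i j) js" "i \<in> set js" "dep x i"
  shows "proj i x js = [i]"
  using assms
proof (induction js)
  case (Cons j js)
  show ?case
  proof (cases "j = i")
    case True
    have "\<forall>k\<in>set js. \<not> dep i k" using Cons.prems(1) True by simp
    moreover have "dep i x" using Cons.prems(3) by (rule dep_sym)
    ultimately have "proj i x js = []"
      by (auto simp: proj_def filter_empty_conv)
    then show ?thesis by (simp add: True proj_Cons)
  next
    case False
    then have i: "i \<in> set js" "\<not> dep j i" using Cons.prems by auto
    then have "j \<noteq> x" using Cons.prems(3) by auto
    with False i Cons show ?thesis by (auto simp: proj_Cons)
  qed
qed simp

lemma teq_append_commute:
  assumes "sorted_wrt (\<lambda>i j. \<not> dep i j) js" "teq (js @ r) (r @ js)"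
    and "i \<in> set js" "dep x i" "x \<noteq> i"
  shows "x \<notin> set r"
proof -
  have "proj i x (js @ r) = proj i x (r @ js)"
    using assms(2,4) dep_sym by (simp add: teq_def)
  then have "i # proj i x r = proj i x r @ [i]"
    using proj_indep[OF assms(1,3,4)] by simp
  from Cons_eq_snoc[OF this] show ?thesis
    using assms(5) by (auto simp: proj_def)
qed


subsection \<open>The presentation\<close>

definition commutation_relations :: "'a set \<Rightarrow> ('a word \<times> 'a word) set" where
  "commutation_relations S =
     {([(i, True), (i, True)], []) | i. i \<in> S} \<union>
     {([(i, True), (j, True)], [(j, True), (i, True)]) | i j. i \<in> S \<and> j \<in> S \<and> \<not> dep i j}"

abbreviation rel :: "'a set \<Rightarrow> ('a word \<times> 'a word) set" where
  "rel S \<equiv> pres_rel S (commutation_relations S)"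

abbreviation pos :: "'a list \<Rightarrow> 'a word" where
  "pos \<equiv> map (\<lambda>x. (x, True))"

text \<open>Generators are involutions, so words without formal inverses suffice;
  \<open>weq_pos\<close> reduces arbitrary words to them.\<close>

definition weq :: "'a set \<Rightarrow> 'a list \<Rightarrow> 'a list \<Rightarrow> bool" where
  "weq S u v \<longleftrightarrow> (pos u, pos v) \<in> rel S"

lemma pos_words_over [simp]: "pos u \<in> words_over S \<longleftrightarrow> set u \<subseteq> S"
  by (induction u) auto

lemma weq_refl: "set u \<subseteq> S \<Longrightarrow> weq S u u"
  unfolding weq_def by (rule pres_rel.refl) simp

lemma weq_sym: "weq S u v \<Longrightarrow> weq S v u"
  unfolding weq_def by (rule pres_rel.sym)

lemma weq_trans [trans]: "weq S u v \<Longrightarrow> weq S v w \<Longrightarrow> weq S u w"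
  unfolding weq_def by (rule pres_rel.trans)

lemma weq_set: "weq S u v \<Longrightarrow> set u \<subseteq> S \<and> set v \<subseteq> S"
  using pres_rel_words unfolding weq_def by force

lemma weq_append: "weq S u u' \<Longrightarrow> weq S v v' \<Longrightarrow> weq S (u @ v) (u' @ v')"
  unfolding weq_def map_append by (rule pres_rel_append)

lemma weq_Cons: "weq S u v \<Longrightarrow> x \<in> S \<Longrightarrow> weq S (x # u) (x # v)"
  using weq_append[of S "[x]" "[x]" u v] weq_refl[of "[x]" S] by simp

lemma weq_square: "x \<in> S \<Longrightarrow> weq S [x, x] []"
  unfolding weq_def
  using pres_rel.relation[of "[(x, True), (x, True)]" "[]" "commutation_relations S" S "[]" "[]"]
  by (auto simp: commutation_relations_def)

lemma weq_swap: "x \<in> S \<Longrightarrow> y \<in> S \<Longrightarrow> \<not> dep x y \<Longrightarrow> weq S [x, y] [y, x]"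
  unfolding weq_def
  using pres_rel.relation[of "[(x, True), (y, True)]" "[(y, True), (x, True)]"
      "commutation_relations S" S "[]" "[]"]
  by (auto simp: commutation_relations_def)

lemma weq_square_Cons: "x \<in> S \<Longrightarrow> set w \<subseteq> S \<Longrightarrow> weq S (x # x # w) w"
  using weq_append[OF weq_square weq_refl, of x S w] by simp

lemma weq_cancel_left:
  assumes "weq S (x # u) (x # v)"
  shows "weq S u v"
proof -
  have S: "x \<in> S" "set u \<subseteq> S" "set v \<subseteq> S" using weq_set[OF assms] by auto
  have "weq S u (x # x # u)" by (rule weq_sym[OF weq_square_Cons[OF S(1,2)]])
  also have "weq S \<dots> (x # x # v)" by (intro weq_Cons assms S)
  also have "weq S \<dots> v" by (rule weq_square_Cons[OF S(1,3)])
  finally show ?thesis .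
qed

lemma weq_swap_append:
  assumes "x \<in> S" "set u \<subseteq> S" "\<forall>y\<in>set u. y = x \<or> \<not> dep x y"
  shows "weq S (x # u) (u @ [x])"
  using assms(2,3)
proof (induction u)
  case Nil
  then show ?case using assms(1) by (simp add: weq_refl)
next
  case (Cons y u)
  have "weq S ([x, y] @ u) ([y, x] @ u)"
  proof (rule weq_append)
    show "weq S [x, y] [y, x]"
      using Cons.prems assms(1) weq_swap[of x S y] weq_refl[of "[x, x]" S] by auto
  qed (use Cons.prems in \<open>simp add: weq_refl\<close>)
  moreover have "weq S (y # x # u) (y # u @ [x])"
    using Cons by (intro weq_Cons) auto
  ultimately show ?case by (simp add: weq_trans)
qed

lemma weq_remove1:
  assumes "set w \<subseteq> S" "initial s w"
  shows "weq S w (s # remove1 s w)"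
  using assms
proof (induction w)
  case (Cons x w)
  show ?case
  proof (cases "x = s")
    case True
    then show ?thesis using Cons.prems by (simp add: weq_refl)
  next
    case False
    then have s: "\<not> dep s x" "initial s w" using Cons.prems by (auto simp: initial_Cons_other)
    have S: "s \<in> S" "x \<in> S" "set (remove1 s w) \<subseteq> S"
      using Cons.prems(1) initial_in_set[OF s(2)] set_remove1_subset[of s w] by auto
    have "weq S (x # w) (x # s # remove1 s w)"
      using Cons s S by (intro weq_Cons) auto
    also have "weq S \<dots> (s # x # remove1 s w)"
      using weq_append[OF weq_sym[OF weq_swap[OF S(1,2) s(1)]] weq_refl[OF S(3)]] by simp
    finally show ?thesis using False by simp
  qed
qed simp

lemma weq_act:
  assumes "s \<in> S" "set w \<subseteq> S"
  shows "weq S (s # w) (act s w)"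
proof (cases "initial s w")
  case True
  have "weq S (s # w) (s # s # remove1 s w)"
    by (intro weq_Cons weq_remove1 assms True)
  also have "weq S \<dots> (remove1 s w)"
    using assms set_remove1_subset[of s w] by (intro weq_square_Cons) auto
  finally show ?thesis using True by (simp add: act_def)
next
  case False
  then show ?thesis using assms by (simp add: act_def weq_refl)
qed

lemma weq_nf: "set w \<subseteq> S \<Longrightarrow> weq S w (nf w)"
proof (induction w)
  case Nil
  then show ?case by (simp add: nf_def weq_refl)
next
  case (Cons x w)
  have "weq S (x # w) (x # nf w)" using Cons by (intro weq_Cons) auto
  also have "weq S \<dots> (act x (nf w))"
    using Cons.prems set_nf[of w] by (intro weq_act) auto
  finally show ?case by (simp add: nf_def)
qed

lemma weq_pos:
  assumes "u \<in> words_over S"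
  shows "(u, pos (map fst u)) \<in> rel S"
  using assms
proof (induction u rule: list.induct)
  case Nil
  then show ?case by (simp add: pres_rel.refl)
next
  case (Cons y u)
  obtain x b where y: "y = (x, b)" by (cases y)
  have x: "x \<in> S" and u: "u \<in> words_over S" using Cons.prems y by auto
  have "([(x, b)], [(x, True)]) \<in> rel S"
  proof (cases b)
    case False
    \<comment> \<open>The word \<open>x x x^-1\<close> equals \<open>x^-1\<close> by the square
      relation and \<open>x\<close> by free cancellation.\<close>
    have "([(x, True), (x, True)] @ [(x, False)], [(x, False)]) \<in> rel S"
      using pres_rel_append_right[of "pos [x, x]" "pos []" S _ "[(x, False)]"] weq_square[OF x] x
      by (simp add: weq_def)
    moreover have "([(x, True)] @ [(x, True), (x, \<not> True)] @ [], [(x, True)] @ []) \<in> rel S"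
      using x by (intro pres_rel.cancel) auto
    ultimately show ?thesis
      using False pres_rel.sym pres_rel.trans by fastforce
  qed (use x in \<open>auto intro: pres_rel.refl\<close>)
  from pres_rel_append[OF this Cons.IH[OF u]] show ?case by (simp add: y)
qed

text \<open>Each defining relation holds for the action on reduced words up to \<open>teq\<close>,
  so related words send \<open>[]\<close> to equivalent words.\<close>

lemma rel_imp_teq:
  assumes "(u, v) \<in> rel S"
  shows "teq (nf (map fst u)) (nf (map fst v))"
  using assms
proof induction
  case (cancel x u v b)
  have "teq (act x (act x (nf (map fst v)))) (nf (map fst v))"
    by (simp add: act_act_same)
  then have "teq (foldr act (map fst u) (act x (act x (nf (map fst v)))))
      (foldr act (map fst u) (nf (map fst v)))"
    by (rule foldr_act_cong)
  then show ?case
    by (simp add: nf_def)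
next
  case (relation l r u v)
  let ?w = "nf (map fst v)"
  have "teq (foldr act (map fst l) ?w) (foldr act (map fst r) ?w)"
    using relation(1) by (auto simp: commutation_relations_def act_act_same act_commute)
  then show ?case
    by (simp add: nf_append foldr_act_cong)
next
  case (sym u v)
  then show ?case by (simp add: teq_sym)
next
  case (trans u v w)
  then show ?case by (auto intro: teq_trans)
qed simp

lemma weq_imp_teq: "weq S u v \<Longrightarrow> teq (nf u) (nf v)"
  unfolding weq_def by (drule rel_imp_teq) (simp add: comp_def)

subsection \<open>Centralisers of products of commuting generators\<close>

text \<open>The generators that commute with all of \<open>js\<close>; the clause
  \<open>x = i\<close> is there because a letter depends on itself yet commutes with itself.\<close>

definition link_closure :: "'a set \<Rightarrow> 'a list \<Rightarrow> 'a set" where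
  "link_closure S js = {x \<in> S. \<forall>i\<in>set js. dep x i \<longrightarrow> x = i}"

lemma weq_commute_link_closure:
  assumes "set js \<subseteq> S" "set h \<subseteq> link_closure S js"
  shows "weq S (h @ js) (js @ h)"
  using assms(2)
proof (induction h)
  case Nil
  then show ?case using assms(1) by (simp add: weq_refl)
next
  case (Cons x h)
  have x: "x \<in> S" "set h \<subseteq> S" "\<forall>y\<in>set js. y = x \<or> \<not> dep x y"
    using Cons.prems by (auto simp: link_closure_def)
  have "weq S (x # h @ js) (x # js @ h)"
    using Cons x by (intro weq_Cons) auto
  also have "weq S \<dots> (js @ x # h)"
    using weq_append[OF weq_swap_append[OF x(1) assms(1) x(3)] weq_refl[OF x(2)]] by simp
  finally show ?case by simp
qed

text \<open>Letters of \<open>js\<close> that are initial in \<open>r\<close> lie in the closure and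
  are stripped off by induction on length. Once none is left, \<open>js @ r\<close> is its own
  normal form, by length so is \<open>r @ js\<close>, and \<open>teq_append_commute\<close>
  applies.\<close>

lemma reduced_commute_link_closure:
  assumes "sorted_wrt (\<lambda>i j. \<not> dep i j) js" "set js \<subseteq> S"
    and "reduced r" "set r \<subseteq> S" "weq S (r @ js) (js @ r)"
  shows "\<exists>h. set h \<subseteq> link_closure S js \<and> weq S r h"
  using assms(3-5)
proof (induction "length r" arbitrary: r rule: less_induct)
  case less
  show ?case
  proof (cases "\<exists>s\<in>set js. initial s r")
    case True
    then obtain s where s: "s \<in> set js" "initial s r" by blast
    have sS: "s \<in> S" using s(1) assms(2) by blast
    have sl: "s \<in> link_closure S js"
      unfolding link_closure_def
    proof (intro CollectI conjI ballI impI sS)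
      fix i assume "i \<in> set js" "dep s i"
      then have "proj i s js = [i]" by (rule proj_indep[OF assms(1)])
      moreover have "s \<in> set (proj i s js)" using s(1) by (simp add: proj_def)
      ultimately show "s = i" by simp
    qed
    let ?r = "remove1 s r"
    have r: "weq S r (s # ?r)" using less.prems(2) s(2) by (rule weq_remove1)
    have r': "set ?r \<subseteq> S" using weq_set[OF r] by simp
    have "weq S (s # ?r @ js) (r @ js)"
      using weq_append[OF weq_sym[OF r] weq_refl[OF assms(2)]] by simp
    also note less.prems(3)
    also have "weq S (js @ r) (js @ s # ?r)"
      by (intro weq_append weq_refl assms(2) r)
    also have "weq S \<dots> (s # js @ ?r)"
      using weq_append[OF weq_sym[OF weq_commute_link_closure[of js S "[s]"]] weq_refl[OF r']]
        assms(2) sl by simp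
    finally have "weq S (?r @ js) (js @ ?r)" by (rule weq_cancel_left)
    moreover have "length ?r < length r"
      using initial_in_set[OF s(2)]
      by (metis length_remove1 length_pos_if_in_set diff_less zero_less_one)
    moreover have "reduced ?r"
      using reduced_remove1[OF less.prems(1) s(2)] ..
    ultimately obtain h where h: "set h \<subseteq> link_closure S js" "weq S ?r h"
      using less.hyps r' by blast
    have "weq S r (s # h)"
      using r weq_Cons[OF h(2) sS] by (rule weq_trans)
    with h sl show ?thesis by (intro exI[of _ "s # h"]) auto
  next
    case False
    have teq: "teq (nf (r @ js)) (nf (js @ r))"
      using less.prems(3) by (rule weq_imp_teq)
    have 1: "nf (js @ r) = js @ r"
      using foldr_act_append[OF assms(1)] False by (simp add: nf_append nf_reduced less.prems(1))
    have "length (nf (r @ js)) = length (r @ js)"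
      using mset_eq_length[OF teq_mset[OF teq]] 1 by simp
    then have "nf (r @ js) = r @ js" by (rule nf_eq_if_length)
    with teq 1 have "teq (js @ r) (r @ js)" by (simp add: teq_sym)
    from teq_append_commute[OF assms(1) this]
    have "set r \<subseteq> link_closure S js"
      using less.prems(2) by (auto simp: link_closure_def)
    then show ?thesis using less.prems(2) by (blast intro: weq_refl)
  qed
qed

lemma commute_link_closure:
  assumes "sorted_wrt (\<lambda>i j. \<not> dep i j) js" "set js \<subseteq> S"
    and "set g \<subseteq> S" "weq S (g @ js) (js @ g)"
  shows "\<exists>h. set h \<subseteq> link_closure S js \<and> weq S g h"
proof -
  have g: "weq S g (nf g)" using assms(3) by (rule weq_nf)
  have "weq S (nf g @ js) (g @ js)"
    by (intro weq_append weq_sym[OF g] weq_refl assms(2))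
  also note assms(4)
  also have "weq S (js @ g) (js @ nf g)"
    by (intro weq_append g weq_refl assms(2))
  finally obtain h where "set h \<subseteq> link_closure S js" "weq S (nf g) h"
    using reduced_commute_link_closure[OF assms(1,2), of "nf g"] weq_set[OF g] by auto
  with g show ?thesis by (blast intro: weq_trans)
qed

subsection \<open>Passage to the presented group\<close>

abbreviation racg :: "'a set \<Rightarrow> 'a word set monoid" where
  "racg S \<equiv> presented_group S (commutation_relations S)"

definition cls :: "'a set \<Rightarrow> 'a list \<Rightarrow> 'a word set" where
  "cls S u = rel S `` {pos u}"

lemma cls_eq_iff: "set u \<subseteq> S \<Longrightarrow> set v \<subseteq> S \<Longrightarrow> cls S u = cls S v \<longleftrightarrow> weq S u v"
  unfolding cls_def weq_def by (rule eq_equiv_class_iff[OF equiv_pres_rel]) simp_all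

lemma cls_mult:
  "set u \<subseteq> S \<Longrightarrow> set v \<subseteq> S \<Longrightarrow> cls S u \<otimes>\<^bsub>racg S\<^esub> cls S v = cls S (u @ v)"
  unfolding cls_def map_append by (rule presented_group_mult) simp_all

lemma carrier_racg: "carrier (racg S) = cls S ` {u. set u \<subseteq> S}"
proof -
  have eq: "rel S `` {u} = cls S (map fst u)" if "u \<in> words_over S" for u
    unfolding cls_def using weq_pos[OF that] by (rule equiv_class_eq[OF equiv_pres_rel])
  have "(\<lambda>u. rel S `` {u}) ` words_over S = cls S ` {u. set u \<subseteq> S}"
  proof (intro equalityI image_subsetI)
    fix u assume "u \<in> words_over S"
    then show "rel S `` {u} \<in> cls S ` {u. set u \<subseteq> S}"
      by (subst eq) (force intro!: imageI)+
  next
    fix u assume "u \<in> {u. set u \<subseteq> S}"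
    then have "pos u \<in> words_over S" by simp
    then show "cls S u \<in> (\<lambda>u. rel S `` {u}) ` words_over S"
      unfolding cls_def by (rule imageI)
  qed
  then show ?thesis
    by (simp add: presented_group_def quotient_def UNION_singleton_eq_range)
qed

lemma cls_foldr:
  assumes "set js \<subseteq> S"
  shows "foldr (\<otimes>\<^bsub>racg S\<^esub>) (map (\<lambda>i. cls S [i]) js) \<one>\<^bsub>racg S\<^esub> = cls S js"
  using assms
proof (induction js)
  case Nil
  then show ?case by (simp add: presented_group_def cls_def)
next
  case (Cons j js)
  then show ?case using cls_mult[of "[j]" S js] by simp
qed

text \<open>\<open>commute_link_closure\<close> rewrites a centralising word over the closure, and
  \<open>weq_commute_link_closure\<close> is the converse. The right-hand side is the standard
  parabolic subgroup on the closure.\<close>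

theorem centraliser_racg:
  assumes "sorted_wrt (\<lambda>i j. \<not> dep i j) js" "set js \<subseteq> S"
  shows "centraliser (racg S) (cls S js) = cls S ` {h. set h \<subseteq> link_closure S js}"
proof -
  have sub: "link_closure S js \<subseteq> S" by (auto simp: link_closure_def)
  have "centraliser (racg S) (cls S js) = cls S ` {g. set g \<subseteq> S \<and> weq S (g @ js) (js @ g)}"
    unfolding centraliser_def carrier_racg
    using assms(2) by (auto simp: cls_mult simp flip: cls_eq_iff)
  also have "\<dots> = cls S ` {h. set h \<subseteq> link_closure S js}"
  proof (intro equalityI subsetI)
    fix c assume "c \<in> cls S ` {g. set g \<subseteq> S \<and> weq S (g @ js) (js @ g)}"
    then obtain g where g: "c = cls S g" "set g \<subseteq> S" "weq S (g @ js) (js @ g)" by blast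
    obtain h where "set h \<subseteq> link_closure S js" "weq S g h"
      using commute_link_closure[OF assms g(2,3)] by blast
    then show "c \<in> cls S ` {h. set h \<subseteq> link_closure S js}"
      using g cls_eq_iff[of g S h] sub by blast
  next
    fix c assume "c \<in> cls S ` {h. set h \<subseteq> link_closure S js}"
    then show "c \<in> cls S ` {g. set g \<subseteq> S \<and> weq S (g @ js) (js @ g)}"
      using weq_commute_link_closure[OF assms(2)] sub by blast
  qed
  finally show ?thesis .
qed

text \<open>Any word for the class of \<open>[x]\<close> has a normal form with letter set
  \<open>{x}\<close>, and normalising never introduces letters.\<close>

lemma cls_parabolic_inject:
  assumes "A \<subseteq> S" "B \<subseteq> S"
    and "cls S ` {h. set h \<subseteq> A} = cls S ` {h. set h \<subseteq> B}"
  shows "A = B"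
proof -
  have "A \<subseteq> B" if "A \<subseteq> S" "B \<subseteq> S" "cls S ` {h. set h \<subseteq> A} \<subseteq> cls S ` {h. set h \<subseteq> B}" for A B
  proof
    fix x assume x: "x \<in> A"
    then have "cls S [x] \<in> cls S ` {h. set h \<subseteq> A}" by auto
    with that(3) obtain h where h: "set h \<subseteq> B" "cls S [x] = cls S h" by blast
    then have "weq S [x] h" using x that cls_eq_iff[of "[x]" S h] by auto
    from mset_eq_setD[OF teq_mset[OF weq_imp_teq[OF this]]]
    have "set (nf h) = {x}" by (simp add: nf_reduced)
    with h(1) set_nf[of h] show "x \<in> B" by auto
  qed
  with assms show ?thesis by (metis subset_antisym subset_refl)
qed

end

section \<open>Closed neighbourhood patterns and compositions\<close>

text \<open>A part 4 has the same walls as two parts 2; excluding it makes the composition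
  unique.\<close>

definition parts :: "nat set" where
  "parts = {2, 3} \<union> {5..}"

definition compositions :: "nat \<Rightarrow> nat list set" where
  "compositions N = {ps. set ps \<subseteq> parts \<and> sum_list ps = N}"

text \<open>The neighbours of the partial sums, looking only inwards at the two end points. The letter
  \<open>s\<^sub>i\<close> sits at position \<open>i + 1\<close>, which puts the virtual letters \<open>-1\<close> and \<open>n + 1\<close> at \<open>0\<close> and \<open>n + 2\<close>.\<close>

primrec walls :: "nat \<Rightarrow> nat list \<Rightarrow> nat set" where
  "walls a [] = {}"
| "walls a (p # ps) = {a + 1, a + p - 1} \<union> walls (a + p) ps"

definition sparse :: "nat list \<Rightarrow> bool" where
  "sparse = sorted_wrt (\<lambda>i j. i + 2 \<le> j)"

section \<open>From sparse lists to compositions and back\<close>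

lemma walls_append: "walls a (ps @ qs) = walls a ps \<union> walls (a + sum_list ps) qs"
  by (induction ps arbitrary: a) (auto simp: add.assoc)

lemma part_refinement:
  assumes "2 \<le> p"
  obtains qs where "set qs \<subseteq> parts" "sum_list qs = p" "qs \<noteq> []" "walls a qs = {a + 1, a + p - 1}"
proof (cases "p = 4")
  case True
  show ?thesis
    by (rule that[of "[2, 2]"]) (auto simp: True parts_def)
next
  case False
  show ?thesis
    by (rule that[of "[p]"]) (use assms False in \<open>auto simp: parts_def\<close>)
qed

text \<open>The parts refine the gaps between \<open>a\<close>, the positions \<open>i + 1\<close>
  for \<open>i\<close> in \<open>js\<close>, and \<open>M\<close>; the neighbours of letter
  \<open>i\<close> sit at \<open>i\<close> and \<open>i + 2\<close>. The length is only bounded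
  below, since a gap of 4 yields two parts.\<close>

lemma sparse_walls:
  assumes "sparse js" "\<forall>i\<in>set js. a < i \<and> i + 3 \<le> M" "a + 2 \<le> M"
  shows "\<exists>ps. set ps \<subseteq> parts \<and> a + sum_list ps = M \<and> length js < length ps \<and>
    walls a ps = {a + 1, M - 1} \<union> (set js \<union> (\<lambda>i. i + 2) ` set js)"
  using assms
proof (induction js arbitrary: a)
  case Nil
  then have "2 \<le> M - a" by simp
  then obtain qs where "set qs \<subseteq> parts" "sum_list qs = M - a" "qs \<noteq> []"
    "walls a qs = {a + 1, a + (M - a) - 1}"
    by (rule part_refinement)
  then show ?case using Nil.prems by (intro exI[of _ qs]) auto
next
  case (Cons i js)
  have i: "a < i" "i + 3 \<le> M" using Cons.prems by auto
  then have "2 \<le> i + 1 - a" by simp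
  then obtain qs where qs: "set qs \<subseteq> parts" "sum_list qs = i + 1 - a" "qs \<noteq> []"
    "walls a qs = {a + 1, a + (i + 1 - a) - 1}"
    by (rule part_refinement)
  have sum: "a + sum_list qs = i + 1" using qs(2) i by simp
  have "\<exists>ps. set ps \<subseteq> parts \<and> i + 1 + sum_list ps = M \<and> length js < length ps \<and>
    walls (i + 1) ps = {i + 1 + 1, M - 1} \<union> (set js \<union> (\<lambda>i. i + 2) ` set js)"
    using Cons.prems i by (intro Cons.IH) (auto simp: sparse_def)
  then obtain ps where ps: "set ps \<subseteq> parts" "i + 1 + sum_list ps = M" "length js < length ps"
    "walls (i + 1) ps = {i + 1 + 1, M - 1} \<union> (set js \<union> (\<lambda>i. i + 2) ` set js)"
    by blast
  have "0 < length qs" using qs(3) by simp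
  with ps(3) have "length (i # js) < length (qs @ ps)" by (simp del: length_greater_0_conv)
  moreover have "walls a (qs @ ps) =
      {a + 1, M - 1} \<union> (set (i # js) \<union> (\<lambda>i. i + 2) ` set (i # js))"
    unfolding walls_append sum ps(4) qs(4) using i by auto
  ultimately show ?case
    using qs(1) ps(1,2) sum by (intro exI[of _ "qs @ ps"]) auto
qed

text \<open>Every inner partial sum becomes the position of a letter, whose index is one less. No
  parts are merged, so the lengths match exactly.\<close>

lemma walls_sparse:
  assumes "set ps \<subseteq> parts" "ps \<noteq> []"
  shows "\<exists>js. sparse js \<and> length ps = Suc (length js) \<and>
    (\<forall>i\<in>set js. a < i \<and> i + 3 \<le> a + sum_list ps) \<and>
    walls a ps = {a + 1, a + sum_list ps - 1} \<union> (set js \<union> (\<lambda>i. i + 2) ` set js)"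
  using assms
proof (induction ps arbitrary: a)
  case (Cons p ps)
  have p: "2 \<le> p" using Cons.prems by (auto simp: parts_def)
  show ?case
  proof (cases "ps = []")
    case True
    then show ?thesis by (intro exI[of _ "[]"]) (simp add: sparse_def)
  next
    case False
    then have "hd ps \<in> parts" "sum_list ps = hd ps + sum_list (tl ps)"
      using Cons.prems by (cases ps; auto)+
    then have sum: "2 \<le> sum_list ps" by (auto simp: parts_def)
    obtain js where js: "sparse js" "length ps = Suc (length js)"
      "\<forall>i\<in>set js. a + p < i \<and> i + 3 \<le> a + p + sum_list ps"
      "walls (a + p) ps = {a + p + 1, a + p + sum_list ps - 1} \<union> (set js \<union> (\<lambda>i. i + 2) ` set js)"
      using Cons.IH[of "a + p"] Cons.prems False by auto
    have "sparse ((a + p - 1) # js)"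
      using js(1,3) p by (fastforce simp: sparse_def)
    moreover have "walls a (p # ps) = {a + 1, a + sum_list (p # ps) - 1} \<union>
        (set ((a + p - 1) # js) \<union> (\<lambda>i. i + 2) ` set ((a + p - 1) # js))"
      using p by (auto simp: js(4) add.assoc)
    ultimately show ?thesis
      using js(2,3) p sum by (intro exI[of _ "(a + p - 1) # js"]) auto
  qed
qed simp

section \<open>Recovering a composition from its walls\<close>

lemma walls_lower: "set ps \<subseteq> parts \<Longrightarrow> x \<in> walls a ps \<Longrightarrow> a < x"
proof (induction ps arbitrary: a)
  case (Cons p ps)
  then have "2 \<le> p" "x = a + 1 \<or> x = a + p - 1 \<or> a + p < x"
    using Cons.IH[of "a + p"] by (auto simp: parts_def)
  then show ?case by auto
qed simp

text \<open>If \<open>p < q\<close>, both walls beside the cut at \<open>a + p\<close> must occur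
  among the walls of the second list. This forces \<open>p = 2\<close> and \<open>q = 4\<close>, but
  4 is not a part.\<close>

lemma walls_first_le:
  assumes "set (p # ps) \<subseteq> parts" "set (q # qs) \<subseteq> parts"
    and "sum_list (p # ps) = sum_list (q # qs)" "walls a (p # ps) = walls a (q # qs)"
  shows "q \<le> p"
proof (rule ccontr)
  assume "\<not> q \<le> p"
  then have pq: "p < q" by simp
  have low: "x = a + 1 \<or> x = a + q - 1 \<or> a + q < x" if "x \<in> walls a (p # ps)" for x
    using that walls_lower[of qs x "a + q"] assms(2) unfolding assms(4) by auto
  have "ps \<noteq> []" using assms(3) pq by auto
  then have "a + p + 1 \<in> walls a (p # ps)" by (cases ps) auto
  from low[OF this] have "q = p + 2" using pq assms(1) by (auto simp: parts_def)
  moreover have "a + p - 1 \<in> walls a (p # ps)" by simp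
  from low[OF this] have "p = 2" using pq assms(1) by (auto simp: parts_def)
  ultimately show False using assms(2) by (auto simp: parts_def)
qed

text \<open>The first parts agree by \<open>walls_first_le\<close> used in both directions, and the
  walls beyond \<open>a + p\<close> are those of the tails.\<close>

lemma walls_inject:
  assumes "set ps \<subseteq> parts" "set qs \<subseteq> parts" "sum_list ps = sum_list qs" "walls a ps = walls a qs"
  shows "ps = qs"
  using assms
proof (induction ps arbitrary: a qs)
  case Nil
  then show ?case by (cases qs) (auto simp: parts_def)
next
  case (Cons p ps)
  then obtain q qs' where qs: "qs = q # qs'"
    by (cases qs) (auto simp: parts_def)
  have pq: "p = q"
    using walls_first_le[of p ps q qs' a] walls_first_le[of q qs' p ps a] Cons.prems
    unfolding qs by (intro antisym) simp_all
  have tail: "walls (a + p) rs = {x \<in> walls a (p # rs). a + p < x}" if "set rs \<subseteq> parts" for rs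
    using walls_lower[OF that, of _ "a + p"] Cons.prems(1) by (auto simp: parts_def)
  have "walls (a + p) ps = walls (a + p) qs'"
  proof -
    have "walls (a + p) ps = {x \<in> walls a (p # ps). a + p < x}"
      using Cons.prems(1) by (intro tail) simp
    also have "\<dots> = {x \<in> walls a (p # qs'). a + p < x}"
      using Cons.prems(4) by (simp only: qs pq)
    also have "\<dots> = walls (a + p) qs'"
      using Cons.prems(2) qs by (intro tail[symmetric]) simp
    finally show ?thesis .
  qed
  moreover have "set ps \<subseteq> parts" "set qs' \<subseteq> parts" "sum_list ps = sum_list qs'"
    using Cons.prems(1-3) by (simp_all add: qs pq)
  ultimately have "ps = qs'" by (intro Cons.IH)
  then show ?case by (simp add: qs pq)
qed

section \<open>Counting compositions\<close>

lemma compositions_0: "compositions 0 = {[]}"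
proof -
  have "ps = []" if "set ps \<subseteq> parts" "sum_list ps = 0" for ps
    using that by (cases ps) (auto simp: parts_def)
  then show ?thesis by (auto simp: compositions_def)
qed

lemma compositions_1: "compositions (Suc 0) = {}"
proof -
  have "sum_list ps \<noteq> Suc 0" if "set ps \<subseteq> parts" for ps
    using that by (cases ps) (auto simp: parts_def)
  then show ?thesis by (auto simp: compositions_def)
qed

text \<open>Here \<open>j\<close> is the sum after the first part: \<open>j \<le> n\<close> makes
  that part at least 2, and \<open>j + 2 \<noteq> n\<close> keeps it from being 4.\<close>

lemma compositions_step:
  "compositions (n + 2) = (\<Union>j\<in>{j. j \<le> n \<and> j + 2 \<noteq> n}. (#) (n + 2 - j) ` compositions j)"
proof (intro equalityI subsetI)
  fix ps assume ps: "ps \<in> compositions (n + 2)"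
  then obtain p qs where pq: "ps = p # qs" by (cases ps) (auto simp: compositions_def)
  have "qs \<in> compositions (sum_list qs)" "p \<in> parts" "p + sum_list qs = n + 2"
    using ps pq by (auto simp: compositions_def)
  moreover from this have "p = n + 2 - sum_list qs" "sum_list qs \<le> n" "sum_list qs + 2 \<noteq> n"
    by (auto simp: parts_def)
  ultimately show "ps \<in> (\<Union>j\<in>{j. j \<le> n \<and> j + 2 \<noteq> n}. (#) (n + 2 - j) ` compositions j)"
    unfolding pq by blast
qed (auto simp: compositions_def parts_def)

lemma finite_compositions: "finite (compositions n)"
proof (induction n rule: less_induct)
  case (less n)
  show ?case
  proof (cases "n < 2")
    case True
    then have "n = 0 \<or> n = Suc 0" by auto
    then show ?thesis by (auto simp: compositions_0 compositions_1)
  next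
    case False
    then obtain m where m: "n = m + 2" by (metis add.commute le_Suc_ex not_less)
    show ?thesis using less unfolding m compositions_step by auto
  qed
qed

lemma card_compositions_step:
  "card (compositions (n + 2)) = (\<Sum>j\<in>{j. j \<le> n \<and> j + 2 \<noteq> n}. card (compositions j))"
proof -
  have "card (\<Union>j\<in>{j. j \<le> n \<and> j + 2 \<noteq> n}. (#) (n + 2 - j) ` compositions j) =
      (\<Sum>j\<in>{j. j \<le> n \<and> j + 2 \<noteq> n}. card ((#) (n + 2 - j) ` compositions j))"
    by (rule card_UN_disjoint) (auto simp: finite_compositions)
  then show ?thesis
    by (simp add: compositions_step card_image del: add_2_eq_Suc')
qed

lemma card_compositions_rec:
  assumes "2 \<le> n"
  shows "card (compositions (n + 2)) + card (compositions (n - 2)) = (\<Sum>j\<le>n. card (compositions j))"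
proof -
  \<comment> \<open>The missing index \<open>n - 2\<close> is what a first part 4 would leave;
    adding its term completes the sum.\<close>
  have "{j. j \<le> n \<and> j + 2 \<noteq> n} = {..n} - {n - 2}" using assms by auto
  then show ?thesis
    using sum.remove[of "{..n}" "n - 2" "\<lambda>j. card (compositions j)"]
    by (simp add: card_compositions_step del: add_2_eq_Suc')
qed

text \<open>The counts for 0 to 4 are 1, 0, 1, 1, 1. A sum of \<open>twin_lambda i\<close> from
  \<open>i = 3\<close> on only reaches compositions of 5 and more.\<close>

lemma sum_card_compositions_4: "(\<Sum>j\<le>4. card (compositions j)) = 4"
proof -
  have 2: "card (compositions 2) = 1"
  proof -
    have "{j. j = 0 \<and> j + 2 \<noteq> (0::nat)} = {0}" by auto
    then show ?thesis
      using card_compositions_step[of 0] by (simp add: compositions_0 flip: numeral_2_eq_2)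
  qed
  have 3: "card (compositions 3) = 1"
  proof -
    have "{j. j \<le> 1 \<and> j + 2 \<noteq> (1::nat)} = {0, 1}" by auto
    then show ?thesis
      using card_compositions_step[of 1]
      by (simp add: compositions_0 compositions_1 flip: numeral_3_eq_3)
  qed
  have 4: "card (compositions 4) = 1"
  proof -
    have "{j. j \<le> 2 \<and> j + 2 \<noteq> (2::nat)} = {1, 2}" by auto
    then show ?thesis
      using card_compositions_step[of 2] 2 by (simp add: compositions_1 del: add_2_eq_Suc')
  qed
  have "{..4} = {0, 1, 2, 3, 4::nat}" by auto
  then show ?thesis
    using 2 3 4 by (simp add: compositions_0 compositions_1)
qed

section \<open>Twin groups\<close>

interpretation twin: dependence "\<lambda>i j. \<bar>int i - int j\<bar> < 2"
  by unfold_locales auto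

section \<open>Centralisers in the twin group\<close>

definition index_lists :: "nat \<Rightarrow> nat list set" where
  "index_lists n = {js. js \<noteq> [] \<and> set js \<subseteq> {1..n - 1} \<and> sparse js}"

lemma twin_relations_eq: "twin_relations n = twin.commutation_relations {1..n - 1}"
  unfolding twin_relations_def twin.commutation_relations_def not_less ..

lemma twin_group_eq: "twin_group n = twin.racg {1..n - 1}"
  by (simp add: twin_group_def twin_relations_eq)

lemma twin_gen_eq: "twin_gen n i = twin.cls {1..n - 1} [i]"
  by (simp add: twin_gen_def twin.cls_def twin_relations_eq)

lemma successively_sparse: "successively (\<lambda>i j. i + 2 \<le> j) js \<longleftrightarrow> sparse js"
  unfolding sparse_def by (rule successively_conv_sorted_wrt) (auto intro: transpI)

lemma cyc_red_involutions_eq: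
  "cyc_red_involutions n = twin.cls {1..n - 1} ` index_lists n"
proof -
  have foldr: "foldr (\<otimes>\<^bsub>twin_group n\<^esub>) (map (twin_gen n) js) \<one>\<^bsub>twin_group n\<^esub> = twin.cls {1..n - 1} js"
    if "set js \<subseteq> {1..n - 1}" for js
    using twin.cls_foldr[OF that] unfolding twin_gen_eq[abs_def] twin_group_eq .
  have "cyc_red_involutions n =
      (\<lambda>js. foldr (\<otimes>\<^bsub>twin_group n\<^esub>) (map (twin_gen n) js) \<one>\<^bsub>twin_group n\<^esub>) ` index_lists n"
    unfolding cyc_red_involutions_def successively_sparse index_lists_def by blast
  also have "\<dots> = twin.cls {1..n - 1} ` index_lists n"
  proof (rule image_cong[OF HOL.refl])
    fix js assume "js \<in> index_lists n"
    then have "set js \<subseteq> {1..n - 1}" by (simp add: index_lists_def)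
    then show "foldr (\<otimes>\<^bsub>twin_group n\<^esub>) (map (twin_gen n) js) \<one>\<^bsub>twin_group n\<^esub> = twin.cls {1..n - 1} js"
      by (rule foldr)
  qed
  finally show ?thesis .
qed

text \<open>Distinct closures give distinct parabolic subgroups, so counting centralisers amounts to
  counting closures.\<close>

lemma twin_lambda_link_closures:
  "twin_lambda n = card (twin.link_closure {1..n - 1} ` index_lists n)"
proof -
  let ?S = "{1..n - 1}"
  let ?P = "\<lambda>A. twin.cls ?S ` {h. set h \<subseteq> A}"
  have "centraliser (twin_group n) (twin.cls ?S js) = ?P (twin.link_closure ?S js)"
    if "js \<in> index_lists n" for js
    unfolding twin_group_eq
  proof (rule twin.centraliser_racg)
    show "sorted_wrt (\<lambda>i j. \<not> \<bar>int i - int j\<bar> < 2) js"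
      using that by (auto simp: index_lists_def sparse_def elim!: sorted_wrt_mono_rel[rotated])
  qed (use that in \<open>simp add: index_lists_def\<close>)
  then have "centraliser (twin_group n) ` cyc_red_involutions n =
      ?P ` twin.link_closure ?S ` index_lists n"
    unfolding cyc_red_involutions_eq by (simp add: image_image)
  moreover have "inj_on ?P (twin.link_closure ?S ` index_lists n)"
  proof (rule inj_onI)
    fix A B
    assume AB: "A \<in> twin.link_closure ?S ` index_lists n" "B \<in> twin.link_closure ?S ` index_lists n"
      and eq: "?P A = ?P B"
    have "A \<subseteq> ?S" "B \<subseteq> ?S" using AB by (auto simp: twin.link_closure_def)
    then show "A = B" using eq by (rule twin.cls_parabolic_inject)
  qed
  ultimately show ?thesis
    unfolding twin_lambda_def by (simp add: card_image)
qed

text \<open>Letter \<open>x\<close> fails to commute with letter \<open>i\<close> exactly when its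
  position \<open>Suc x\<close> is \<open>i\<close> or \<open>i + 2\<close>. The outer walls 1 and
  \<open>n + 1\<close> exclude nothing, as \<open>Suc x\<close> lies between 2 and
  \<open>n\<close>.\<close>

lemma link_closure_walls:
  assumes "sparse js" "walls 0 ps = {1, n + 1} \<union> (set js \<union> (\<lambda>i. i + 2) ` set js)"
  shows "twin.link_closure {1..n - 1} js = {x \<in> {1..n - 1}. Suc x \<notin> walls 0 ps}"
proof -
  have "(\<forall>i\<in>set js. \<bar>int x - int i\<bar> < 2 \<longrightarrow> x = i) \<longleftrightarrow> Suc x \<notin> walls 0 ps"
    if "x \<in> {1..n - 1}" for x
  proof -
    have "(\<bar>int x - int i\<bar> < 2 \<longrightarrow> x = i) \<longleftrightarrow> Suc x \<noteq> i \<and> Suc x \<noteq> i + 2" for i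
      by auto
    then show ?thesis
      using that unfolding assms(2) by auto
  qed
  then show ?thesis unfolding twin.link_closure_def by auto
qed

text \<open>A nonempty list of letters means at least one cut, hence at least two parts.\<close>

lemma twin_lambda_compositions:
  assumes "2 \<le> n"
  shows "twin_lambda n = card {ps \<in> compositions (n + 2). 2 \<le> length ps}"
proof -
  let ?S = "{1..n - 1}" and ?C = "{ps \<in> compositions (n + 2). 2 \<le> length ps}"
  let ?J = "\<lambda>ps. {x \<in> ?S. Suc x \<notin> walls 0 ps}"
  have "twin.link_closure ?S ` index_lists n = ?J ` ?C"
  proof (intro equalityI image_subsetI)
    fix js assume js: "js \<in> index_lists n"
    then have sp: "sparse js" and ne: "js \<noteq> []" and sub: "set js \<subseteq> ?S"
      by (simp_all add: index_lists_def)
    have bounds: "\<forall>i\<in>set js. 0 < i \<and> i + 3 \<le> n + 2"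
    proof
      fix i assume "i \<in> set js"
      with sub have "i \<in> ?S" by blast
      with assms show "0 < i \<and> i + 3 \<le> n + 2" by auto
    qed
    obtain ps where ps: "set ps \<subseteq> parts" "sum_list ps = n + 2" "length js < length ps"
      "walls 0 ps = {1, n + 1} \<union> (set js \<union> (\<lambda>i. i + 2) ` set js)"
      using sparse_walls[OF sp bounds] by auto
    have "0 < length js" using ne by simp
    then have "2 \<le> length ps" using ps(3) by linarith
    then have "ps \<in> ?C" using ps(1,2) by (simp add: compositions_def)
    then show "twin.link_closure ?S js \<in> ?J ` ?C"
      using link_closure_walls[OF sp ps(4)] by blast
  next
    fix ps assume ps: "ps \<in> ?C"
    then have "set ps \<subseteq> parts" "ps \<noteq> []" "sum_list ps = n + 2" by (auto simp: compositions_def)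
    then obtain js where js: "sparse js" "length ps = Suc (length js)"
      "\<forall>i\<in>set js. 0 < i \<and> i + 3 \<le> n + 2"
      "walls 0 ps = {1, n + 1} \<union> (set js \<union> (\<lambda>i. i + 2) ` set js)"
      using walls_sparse[of ps 0] by auto
    have "set js \<subseteq> ?S"
    proof
      fix i assume "i \<in> set js"
      with js(3) have "0 < i" "i + 3 \<le> n + 2" by auto
      then show "i \<in> ?S" by simp
    qed
    moreover have "js \<noteq> []" using ps js(2) by auto
    ultimately have "js \<in> index_lists n" using js(1) by (simp add: index_lists_def)
    then show "?J ps \<in> twin.link_closure ?S ` index_lists n"
      using link_closure_walls[OF js(1,4)] by blast
  qed
  moreover have "inj_on ?J ?C"
  proof (rule inj_onI)
    \<comment> \<open>The closure determines the walls: the outer two are always present, and all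
      others lie between 2 and \<open>n\<close>.\<close>
    have ext: "walls 0 ps = {1, n + 1} \<union> Suc ` (?S - ?J ps)" if ps: "ps \<in> ?C" for ps
    proof -
      have "set ps \<subseteq> parts" "ps \<noteq> []" "sum_list ps = n + 2"
        using ps by (auto simp: compositions_def)
      then obtain js where js: "\<forall>i\<in>set js. 0 < i \<and> i + 3 \<le> n + 2"
        "walls 0 ps = {1, n + 1} \<union> (set js \<union> (\<lambda>i. i + 2) ` set js)"
        using walls_sparse[of ps 0] by auto
      show ?thesis
      proof (intro equalityI subsetI)
        fix x assume x: "x \<in> walls 0 ps"
        then have "1 \<le> x" "x \<le> n + 1" using js by auto
        show "x \<in> {1, n + 1} \<union> Suc ` (?S - ?J ps)"
        proof (cases "x = 1 \<or> x = n + 1")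
          case False
          then have "x - 1 \<in> ?S - ?J ps" "x = Suc (x - 1)"
            using x \<open>1 \<le> x\<close> \<open>x \<le> n + 1\<close> by auto
          then show ?thesis by blast
        qed auto
      next
        fix x assume "x \<in> {1, n + 1} \<union> Suc ` (?S - ?J ps)"
        then show "x \<in> walls 0 ps" using js(2) by auto
      qed
    qed
    fix ps qs assume C: "ps \<in> ?C" "qs \<in> ?C" and eq: "?J ps = ?J qs"
    have "{1, n + 1} \<union> Suc ` (?S - ?J ps) = {1, n + 1} \<union> Suc ` (?S - ?J qs)"
      by (simp only: eq)
    then have "walls 0 ps = walls 0 qs"
      by (rule HOL.trans[OF ext[OF C(1)] HOL.trans[OF _ ext[OF C(2), symmetric]]])
    then show "ps = qs"
      using C by (intro walls_inject) (auto simp: compositions_def)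
  qed
  ultimately show ?thesis
    by (simp add: twin_lambda_link_closures card_image)
qed

text \<open>Only \<open>[n + 2]\<close> has fewer than two parts. The bound \<open>3 \<le> n\<close>
  ensures that \<open>n + 2\<close> is a part, which fails for \<open>n = 2\<close>.\<close>

lemma twin_lambda_eq:
  assumes "3 \<le> n"
  shows "int (twin_lambda n) = int (card (compositions (n + 2))) - 1"
proof -
  have "ps = [n + 2]" if "ps \<in> compositions (n + 2)" "\<not> 2 \<le> length ps" for ps
    using that by (cases ps; cases "tl ps") (auto simp: compositions_def)
  moreover have "[n + 2] \<in> compositions (n + 2)"
    using assms by (simp add: compositions_def parts_def)
  ultimately have "compositions (n + 2) = insert [n + 2] {ps \<in> compositions (n + 2). 2 \<le> length ps}"
    by blast
  from arg_cong[OF this, of card] show ?thesis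
    using assms by (simp add: twin_lambda_compositions finite_compositions)
qed

theorem theorem5p3:
  fixes n :: nat
  assumes "n \<ge> 7"
  shows "int (twin_lambda n) =
    (\<Sum>i = 3..n - 2. int (twin_lambda i)) - int (twin_lambda (n - 4)) + int n - 2"
proof -
  let ?c = "\<lambda>j. int (card (compositions j))"
  \<comment> \<open>Each of the \<open>n - 4\<close> summands contributes a correction of 1.\<close>
  have "(\<Sum>i = 3..n - 2. int (twin_lambda i)) = (\<Sum>i = 3..n - 2. ?c (i + 2)) - (int n - 4)"
    using assms by (simp add: twin_lambda_eq sum_subtractf)
  also have "(\<Sum>i = 3..n - 2. ?c (i + 2)) = (\<Sum>j = 5..n. ?c j)"
    using assms sum.shift_bounds_cl_nat_ivl[of ?c 3 2 "n - 2"]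
    by (simp del: add_2_eq_Suc' sum.cl_ivl_Suc)
  also have "(\<Sum>j = 5..n. ?c j) = (\<Sum>j\<le>n. ?c j) - 4"
  proof -
    have "{..n} = {..4} \<union> {5..n}" using assms by auto
    then have "(\<Sum>j\<le>n. ?c j) = (\<Sum>j\<le>4. ?c j) + (\<Sum>j = 5..n. ?c j)"
      by (simp add: sum.union_disjoint)
    then show ?thesis
      using sum_card_compositions_4 by (simp flip: of_nat_sum)
  qed
  also have "(\<Sum>j\<le>n. ?c j) = ?c (n + 2) + ?c (n - 2)"
    using card_compositions_rec[of n] assms by (simp flip: of_nat_sum of_nat_add)
  finally have "(\<Sum>i = 3..n - 2. int (twin_lambda i)) = ?c (n + 2) + ?c (n - 2) - int n"
    by simp
  \<comment> \<open>Since \<open>n - 4 \<ge> 3\<close>, \<open>twin_lambda_eq\<close> turns the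
    count for \<open>n - 2\<close> into \<open>twin_lambda (n - 4) + 1\<close>.\<close>
  moreover have "n - 4 + 2 = n - 2" using assms by simp
  ultimately show ?thesis
    using assms twin_lambda_eq[of n] twin_lambda_eq[of "n - 4"] by simp
qed

end
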